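(* Let $\xi(t)$ be a controlled semi-Markov process with finite state set $X=\{1,\dots,N\}$, with control spaces $(U_i,\mathscr{B}_i)$, $i\in X$, and set of admissible control strategies $\Gamma=\{(\Psi_1,\dots,\Psi_N):\Psi_i\in\Gamma_i,\ i=1,\dots,N\}$ (as defined in the context). Let $U=U_1\times\dots\times U_N$, let $A,B:U\to\mathbb{R}$ be measurable functions, and suppose that the control quality index of a strategy $\Psi=(\Psi_1,\dots,\Psi_N)\in\Gamma$ is $$I(\Psi)=\frac{\int_{U_1}\cdots\int_{U_N}A(u_1,\dots,u_N)\,d\Psi_1(u_1)\cdots d\Psi_N(u_N)}{\int_{U_1}\cdots\int_{U_N}B(u_1,\dots,u_N)\,d\Psi_1(u_1)\cdots d\Psi_N(u_N)}.$$ Consider the optimal control problem of maximizing (respectively, minimizing) $I(\Psi)$ over $\Psi\in\Gamma$. Assume that $B$ is strictly of constant sign on $U$ (strictly positive everywhere or strictly negative everywhere), and let $C(u)=A(u)/B(u)$, $u=(u_1,\dots,u_N)\in U$. Then the following assertions hold. (1) If $C$ is bounded above and attains its global maximum on $U$ at a point $u^{(+)}=(u_1^{(+)},\dots,u_N^{(+)})$, then an optimal control strategy for the maximum problem exists, and the optimum is attained on the deterministic control strategy $\Psi^{*(+)}=(\Psi_1^{*(+)},\dots,\Psi_N^{*(+)})\in\Gamma^*$, where $\Psi_i^{*(+)}$ is concentrated at $u_i^{(+)}$, and $$\max_{\Psi\in\Gamma}I(\Psi)=\max_{\Psi^*\in\Gamma^*}I(\Psi^* )=I(\Psi^{*(+)})=\max_{u\in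 U}\frac{A(u)}{B(u)}=\frac{A(u^{(+)})}{B(u^{(+)})}.$$ Similarly, if $C$ is bounded below and attains its global minimum on $U$ at a point $u^{(-)}=(u_1^{(-)},\dots,u_N^{(-)})$, then an optimal control strategy for the minimum problem exists, and the optimum is attained on the deterministic control strategy $\Psi^{*(-)}=(\Psi_1^{*(-)},\dots,\Psi_N^{*(-)})\in\Gamma^*$, where $\Psi_i^{*(-)}$ is concentrated at $u_i^{(-)}$, and $$\min_{\Psi\in\Gamma}I(\Psi)=\min_{\Psi^*\in\Gamma^*}I(\Psi^* )=I(\Psi^{*(-)})=\min_{u\in U}\frac{A(u)}{B(u)}=\frac{A(u^{(-)})}{B(u^{(-)})}.$$ (2) If $C$ is bounded above but does not attain a global maximum on $U$, then for every $\varepsilon>0$ there is an $\varepsilon$-optimal (for the maximum problem) deterministic control strategy $\Psi^{*(+)}(\varepsilon)=(\Psi_1^{*(+)}(\varepsilon),\dots,\Psi_N^{*(+)}(\varepsilon))$; namely, one may take $\Psi_i^{*(+)}(\varepsilon)$ concentrated at $u_i^{(+)}(\varepsilon)$, where $u^{(+)}(\varepsilon)=(u_1^{(+)}(\varepsilon),\dots,u_N^{(+)}(\varepsilon))\in U$ is an arbitrary point (such points exist) with $$\sup_{u\in U}\frac{A(u)}{B(u)}-\varepsilon<\frac{A(u^{(+)}(\varepsilon))}{B(u^{(+)}(\varepsilon))}<\sup_{u\in U}\frac{A(u)}{B(u)}<\infty.$$ Similarly, if $C$ is bounded below but does not attain a global minimum on $U$, then for every $\varepsilon>0$ there is an $\varepsilon$-optimal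 (for the minimum problem) deterministic control strategy $\Psi^{*(-)}(\varepsilon)=(\Psi_1^{*(-)}(\varepsilon),\dots,\Psi_N^{*(-)}(\varepsilon))$; namely, one may take $\Psi_i^{*(-)}(\varepsilon)$ concentrated at $u_i^{(-)}(\varepsilon)$, where $u^{(-)}(\varepsilon)\in U$ is an arbitrary point (such points exist) with $$-\infty<\inf_{u\in U}\frac{A(u)}{B(u)}<\frac{A(u^{(-)}(\varepsilon))}{B(u^{(-)}(\varepsilon))}<\inf_{u\in U}\frac{A(u)}{B(u)}+\varepsilon.$$ (3) If $C$ is not bounded above, then no optimal control strategy exists for the maximum problem, and there exists a sequence of deterministic control strategies $\Psi^{*(+)}(n)=(\Psi_1^{*(+)}(n),\dots,\Psi_N^{*(+)}(n))$, $n=1,2,\dots$, with $\Psi_i^{*(+)}(n)$ concentrated at a point $u_i^{(+)}(n)\in U_i$, such that $$I(\Psi^{*(+)}(n))=\frac{A(u_1^{(+)}(n),\dots,u_N^{(+)}(n))}{B(u_1^{(+)}(n),\dots,u_N^{(+)}(n))}\to\infty\quad\text{as }n\to\infty.$$ Similarly, if $C$ is not bounded below, then no optimal control strategy exists for the minimum problem, and there exists a sequence of deterministic control strategies $\Psi^{*(-)}(n)=(\Psi_1^{*(-)}(n),\dots,\Psi_N^{*(-)}(n))$, $n=1,2,\dots$, with $\Psi_i^{*(-)}(n)$ concentrated at a point $u_i^{(-)}(n)\in U_i$, such that $$I(\Psi^{*(-)}(n))=\frac{A(u_1^{(-)}(n),\dots,u_N^{(-)}(n))}{B(u_1^{(-)}(n),\dots,u_N^{(-)}(n))}\to-\infty\quad\text{as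 }n\to\infty.$$
   Context: Controlled semi-Markov process. $\xi(t)$, $t\ge0$, is a right-continuous semi-Markov process with finite state set $X=\{1,\dots,N\}$, with random times of state change $0=t_0,t_1,t_2,\dots$, holding times $\theta_n=t_{n+1}-t_n$, and embedded Markov chain $\xi_n=\xi(t_n)$. For each $i\in X$, $(U_i,\mathscr{B}_i)$ is a measurable space with $U_i$ nonempty (the set of admissible controls in state $i$) and $\{u\}\in\mathscr{B}_i$ for every $u\in U_i$. At each time $t_n$, directly after the state change, given $\xi_n=i$, a random control $u_n\in U_i$ is chosen, independently of the past, according to a probability measure $\Psi_i$ on $\mathscr{B}_i$ depending only on $i$. The evolution is given by the semi-Markov functions $Q_{ij}(t,u)=P(\xi_{n+1}=j,\theta_n<t\mid\xi_n=i,u_n=u)$, $t\ge 0$, $u\in U_i$, $i,j\in X$. Put $p_{ij}(u)=\lim_{t\to\infty}Q_{ij}(t,u)$; under the choice $(\Psi_1,\dots,\Psi_N)$ the embedded chain has transition probabilities $p_{ij}=\int_{U_i}p_{ij}(u)\,d\Psi_i(u)$. Strategies. A control strategy is a collection $\Psi=(\Psi_1,\dots,\Psi_N)$ with $\Psi_i\in\Gamma_i$, where $\Gamma_i$ is a given set of probability measures on $\mathscr{B}_i$; it is identified with the product measure $\Psi_1\times\dots\times\Psi_N$ on $U$ with the product $\sigma$-algebra. A probability measure on $\mathscr{B}_i$ is degenerate, with concentration point $u^*\in U_i$, if it assigns mass $1$ to $\{u^*\}$ and mass $0$ to $U_i\setminus\{u^*\}$; $\Gamma_i^*$ is the set of all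 degenerate probability measures on $\mathscr{B}_i$, and $\Gamma^*=\{(\Psi_1^*,\dots,\Psi_N^* ):\Psi_i^*\in\Gamma_i^*\}$ is the set of deterministic strategies. Admissibility. $\Gamma$ is the set of admissible strategies, meaning that the following hold: (i) for all $\Psi\in\Gamma$ the integrals of $A$ and of $B$ in the numerator and denominator of $I(\Psi)$ are defined (as real numbers); (ii) the denominator is nonzero for all $\Psi\in\Gamma$ (this is automatic when $B$ is strictly of constant sign); (iii) $\Gamma_i^*\subset\Gamma_i$ for all $i$, so that $\Gamma^*\subset\Gamma$; (iv) for every $\Psi\in\Gamma$ the embedded Markov chain has precisely one class of positive recurrent states. Optimality. A strategy in $\Gamma$ is optimal for the maximum (minimum) problem if $I$ attains its maximum (minimum) over $\Gamma$ at it. A strategy $\Psi'\in\Gamma$ is $\varepsilon$-optimal for the maximum problem if $I(\Psi')>\sup_{\Psi\in\Gamma}I(\Psi)-\varepsilon$ with the supremum finite, and $\varepsilon$-optimal for the minimum problem if $I(\Psi')<\inf_{\Psi\in\Gamma}I(\Psi)+\varepsilon$ with the infimum finite. *)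

theory Defs
  imports "HOL-Probability.Probability"
begin

text \<open>
  States are \<open>{1..N}\<close>. The measurable space of controls in state \<open>i\<close> is \<open>S i\<close>, of which only
  the carrier and the \<open>\<sigma>\<close>-algebra matter. All control spaces live in one type and may overlap.
\<close>

definition control_spaces :: "nat \<Rightarrow> (nat \<Rightarrow> 'u measure) \<Rightarrow> bool" where
  "control_spaces N S \<longleftrightarrow>
     (\<forall>i\<in>{1..N}. space (S i) \<noteq> {} \<and> (\<forall>u\<in>space (S i). {u} \<in> sets (S i)))"

definition control_product :: "nat \<Rightarrow> (nat \<Rightarrow> 'u measure) \<Rightarrow> (nat \<Rightarrow> 'u) measure" where
  "control_product N S = PiM {1..N} S"


subsection \<open>Semi-Markov functions and the controlled process\<close>

definition limit_prob ::
    "(nat \<Rightarrow> nat \<Rightarrow> real \<Rightarrow> 'u \<Rightarrow> real) \<Rightarrow> nat \<Rightarrow> nat \<Rightarrow> 'u \<Rightarrow> real" where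
  "limit_prob Q i j u = Lim at_top (\<lambda>t. Q i j t u)"

text \<open>
  \<open>Q i j t u\<close> is the conditional probability of \<open>{\<xi>\<^sub>n\<^sub>+\<^sub>1 = j, \<theta>\<^sub>n < t}\<close>. Because of the strict
  inequality it vanishes at \<open>t = 0\<close> and is left continuous in \<open>t\<close>. Its total mass over \<open>j\<close> tends
  to 1 because the holding times are finite.
\<close>

definition semi_markov_functions ::
    "nat \<Rightarrow> (nat \<Rightarrow> 'u measure) \<Rightarrow> (nat \<Rightarrow> nat \<Rightarrow> real \<Rightarrow> 'u \<Rightarrow> real) \<Rightarrow> bool" where
  "semi_markov_functions N S Q \<longleftrightarrow>
     (\<forall>i\<in>{1..N}. \<forall>j\<in>{1..N}.
        (\<forall>t\<ge>0. Q i j t \<in> borel_measurable (S i)) \<and>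
        (\<forall>u\<in>space (S i).
           Q i j 0 u = 0 \<and>
           mono_on {0..} (\<lambda>t. Q i j t u) \<and>
           (\<forall>t>0. continuous (at_left t) (\<lambda>s. Q i j s u)))) \<and>
     (\<forall>i\<in>{1..N}. \<forall>u\<in>space (S i). ((\<lambda>t. \<Sum>j\<in>{1..N}. Q i j t u) \<longlongrightarrow> 1) at_top)"

definition embedded :: "(nat \<Rightarrow> 'w \<Rightarrow> real) \<Rightarrow> (real \<Rightarrow> 'w \<Rightarrow> nat) \<Rightarrow> nat \<Rightarrow> 'w \<Rightarrow> nat" where
  "embedded \<tau> \<xi> n w = \<xi> (\<tau> n w) w"

text \<open>
  The \<open>\<sigma>\<close>-algebra generated by \<open>\<tau>\<^sub>k, \<xi>\<^sub>k\<close> for \<open>k \<le> n\<close> and by the controls \<open>\<upsilon>\<^sub>k\<close> for \<open>k < m\<close>.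
  With \<open>m = n\<close> it is the past directly before the \<open>n\<close>-th control is chosen, with \<open>m = Suc n\<close> the
  past directly after. A control is only ever observed together with the state in which it is
  chosen, since that state determines its \<open>\<sigma>\<close>-algebra.
\<close>

definition history ::
    "nat \<Rightarrow> (nat \<Rightarrow> 'u measure) \<Rightarrow> 'w measure \<Rightarrow> (nat \<Rightarrow> 'w \<Rightarrow> real) \<Rightarrow> (real \<Rightarrow> 'w \<Rightarrow> nat)
       \<Rightarrow> (nat \<Rightarrow> 'w \<Rightarrow> 'u) \<Rightarrow> nat \<Rightarrow> nat \<Rightarrow> 'w measure" where
  "history N S M \<tau> \<xi> \<upsilon> n m = sigma (space M)
     ({{w \<in> space M. \<tau> k w \<in> D} | k D. k \<le> n \<and> D \<in> sets borel}
      \<union> {{w \<in> space M. embedded \<tau> \<xi> k w = i} | k i. k \<le> n \<and> i \<in> {1..N}}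
      \<union> {{w \<in> space M. embedded \<tau> \<xi> k w = i \<and> \<upsilon> k w \<in> D} | k i D.
            k < m \<and> i \<in> {1..N} \<and> D \<in> sets (S i)})"

text \<open>
  The last two clauses are, with regular conditional probabilities written as conditional
  expectations of indicators: given the past and \<open>\<xi>\<^sub>n = i\<close>, the control \<open>\<upsilon>\<^sub>n\<close> has law \<open>\<Psi> i\<close>; given
  the past, \<open>\<xi>\<^sub>n = i\<close> and \<open>\<upsilon>\<^sub>n = u\<close>, the event \<open>{\<xi>\<^sub>n\<^sub>+\<^sub>1 = j, \<theta>\<^sub>n < t}\<close> has probability \<open>Q i j t u\<close>.
\<close>

definition controlled_semi_markov_process ::
    "nat \<Rightarrow> (nat \<Rightarrow> 'u measure) \<Rightarrow> (nat \<Rightarrow> nat \<Rightarrow> real \<Rightarrow> 'u \<Rightarrow> real) \<Rightarrow> (nat \<Rightarrow> 'u measure)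
       \<Rightarrow> 'w measure \<Rightarrow> (nat \<Rightarrow> 'w \<Rightarrow> real) \<Rightarrow> (real \<Rightarrow> 'w \<Rightarrow> nat) \<Rightarrow> (nat \<Rightarrow> 'w \<Rightarrow> 'u) \<Rightarrow> bool" where
  "controlled_semi_markov_process N S Q \<Psi> M \<tau> \<xi> \<upsilon> \<longleftrightarrow>
     prob_space M \<and>
     (\<forall>n. \<tau> n \<in> borel_measurable M) \<and>
     (\<forall>t\<ge>0. \<xi> t \<in> measurable M (count_space {1..N})) \<and>
     (\<forall>n. embedded \<tau> \<xi> n \<in> measurable M (count_space {1..N})) \<and>
     (\<forall>n. \<forall>i\<in>{1..N}. \<forall>D\<in>sets (S i). {w \<in> space M. embedded \<tau> \<xi> n w = i \<and> \<upsilon> n w \<in> D} \<in> sets M) \<and>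
     (\<forall>w\<in>space M.
        \<tau> 0 w = 0 \<and>
        (\<forall>n. \<tau> n w < \<tau> (Suc n) w) \<and>
        (\<forall>t\<ge>0. continuous (at_right t) (\<lambda>s. \<xi> s w)) \<and>
        (\<forall>n t. \<tau> n w \<le> t \<and> t < \<tau> (Suc n) w \<longrightarrow> \<xi> t w = embedded \<tau> \<xi> n w) \<and>
        (\<forall>n. \<upsilon> n w \<in> space (S (embedded \<tau> \<xi> n w)))) \<and>
     (\<forall>n. \<forall>i\<in>{1..N}. \<forall>D\<in>sets (S i). AE w in M.
        embedded \<tau> \<xi> n w = i \<longrightarrow>
        real_cond_exp M (history N S M \<tau> \<xi> \<upsilon> n n)
          (indicator {w \<in> space M. embedded \<tau> \<xi> n w = i \<and> \<upsilon> n w \<in> D}) w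
        = measure (\<Psi> i) D) \<and>
     (\<forall>n. \<forall>i\<in>{1..N}. \<forall>j\<in>{1..N}. \<forall>t\<ge>0. AE w in M.
        embedded \<tau> \<xi> n w = i \<longrightarrow>
        real_cond_exp M (history N S M \<tau> \<xi> \<upsilon> n (Suc n))
          (indicator {w \<in> space M. embedded \<tau> \<xi> (Suc n) w = j \<and> \<tau> (Suc n) w - \<tau> n w < t}) w
        = Q i j t (\<upsilon> n w))"


subsection \<open>The embedded chain\<close>

definition transition_prob ::
    "(nat \<Rightarrow> nat \<Rightarrow> real \<Rightarrow> 'u \<Rightarrow> real) \<Rightarrow> (nat \<Rightarrow> 'u measure) \<Rightarrow> nat \<Rightarrow> nat \<Rightarrow> real" where
  "transition_prob Q \<Psi> i j = (\<integral>u. limit_prob Q i j u \<partial>\<Psi> i)"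

primrec step_prob :: "nat set \<Rightarrow> (nat \<Rightarrow> nat \<Rightarrow> real) \<Rightarrow> nat \<Rightarrow> nat \<Rightarrow> nat \<Rightarrow> real" where
  "step_prob X p 0 i j = (if i = j then 1 else 0)"
| "step_prob X p (Suc n) i j = (\<Sum>k\<in>X. p i k * step_prob X p n k j)"

text \<open>\<open>first_passage X p n i j\<close> is the probability, starting in \<open>i\<close>, that the first visit to \<open>j\<close>
  at a time \<open>\<ge> 1\<close> happens at time \<open>Suc n\<close>.\<close>

primrec first_passage :: "nat set \<Rightarrow> (nat \<Rightarrow> nat \<Rightarrow> real) \<Rightarrow> nat \<Rightarrow> nat \<Rightarrow> nat \<Rightarrow> real" where
  "first_passage X p 0 i j = p i j"
| "first_passage X p (Suc n) i j = (\<Sum>k\<in>X - {j}. p i k * first_passage X p n k j)"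

text \<open>Return is certain and the mean return time is finite.\<close>

definition positive_recurrent :: "nat set \<Rightarrow> (nat \<Rightarrow> nat \<Rightarrow> real) \<Rightarrow> nat \<Rightarrow> bool" where
  "positive_recurrent X p i \<longleftrightarrow>
     (\<lambda>n. first_passage X p n i i) sums 1 \<and>
     summable (\<lambda>n. real (Suc n) * first_passage X p n i i)"

definition communicating :: "nat set \<Rightarrow> (nat \<Rightarrow> nat \<Rightarrow> real) \<Rightarrow> (nat \<times> nat) set" where
  "communicating X p =
     {(i, j). i \<in> X \<and> j \<in> X \<and> (\<exists>n. step_prob X p n i j > 0) \<and> (\<exists>n. step_prob X p n j i > 0)}"

definition one_positive_recurrent_class :: "nat set \<Rightarrow> (nat \<Rightarrow> nat \<Rightarrow> real) \<Rightarrow> bool" where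
  "one_positive_recurrent_class X p \<longleftrightarrow>
     (\<exists>!K. K \<in> X // communicating X p \<and> (\<forall>i\<in>K. positive_recurrent X p i))"


subsection \<open>Strategies and the quality index\<close>

definition strategies :: "nat \<Rightarrow> (nat \<Rightarrow> 'u measure set) \<Rightarrow> (nat \<Rightarrow> 'u measure) set" where
  "strategies N G = (\<Pi>\<^sub>E i\<in>{1..N}. G i)"

definition concentrated_at :: "'u measure \<Rightarrow> 'u \<Rightarrow> 'u measure \<Rightarrow> bool" where
  "concentrated_at R u \<mu> \<longleftrightarrow>
     prob_space \<mu> \<and> sets \<mu> = sets R \<and> u \<in> space R \<and>
     emeasure \<mu> {u} = 1 \<and> emeasure \<mu> (space R - {u}) = 0"

definition degenerate_measures :: "'u measure \<Rightarrow> 'u measure set" where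
  "degenerate_measures R = {\<mu>. \<exists>u. concentrated_at R u \<mu>}"

definition deterministic_strategies ::
    "nat \<Rightarrow> (nat \<Rightarrow> 'u measure) \<Rightarrow> (nat \<Rightarrow> 'u measure) set" where
  "deterministic_strategies N S = strategies N (\<lambda>i. degenerate_measures (S i))"

definition point_strategy ::
    "nat \<Rightarrow> (nat \<Rightarrow> 'u measure) \<Rightarrow> (nat \<Rightarrow> 'u) \<Rightarrow> nat \<Rightarrow> 'u measure" where
  "point_strategy N S u = (\<lambda>i\<in>{1..N}. return (S i) (u i))"

lemma concentrated_at_iff_return:
  assumes "u \<in> space R" "{u} \<in> sets R"
  shows "concentrated_at R u \<mu> \<longleftrightarrow> \<mu> = return R u"
proof
  assume c: "concentrated_at R u \<mu>"
  then have s: "sets \<mu> = sets R" and sp: "space \<mu> = space R"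
    by (auto simp: concentrated_at_def dest: sets_eq_imp_space_eq)
  show "\<mu> = return R u"
  proof (rule measure_eqI)
    show "sets \<mu> = sets (return R u)"
      by (simp add: s)
  next
    fix D assume D: "D \<in> sets \<mu>"
    then have DR: "D \<in> sets R"
      by (simp add: s)
    show "emeasure \<mu> D = emeasure (return R u) D"
    proof (cases "u \<in> D")
      case True
      have "emeasure \<mu> {u} \<le> emeasure \<mu> D"
        using True D by (intro emeasure_mono) auto
      moreover have "emeasure \<mu> D \<le> 1"
        using c by (auto simp: concentrated_at_def intro: prob_space.measure_le_1)
      ultimately show ?thesis
        using c True DR by (auto simp: concentrated_at_def intro: antisym)
    next
      case False
      have "emeasure \<mu> D \<le> emeasure \<mu> (space R - {u})"
        using False D assms(2) sets.sets_into_space[OF DR]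
        by (intro emeasure_mono) (auto simp: s)
      then show ?thesis
        using c False DR by (simp add: concentrated_at_def)
    qed
  qed
next
  assume "\<mu> = return R u"
  moreover have "space R - {u} \<in> sets R"
    using assms(2) by auto
  ultimately show "concentrated_at R u \<mu>"
    using assms by (auto simp: concentrated_at_def intro: prob_space_return)
qed

text \<open>A strategy is identified with its product measure, and the repeated integral over
  \<open>\<Psi>\<^sub>1, \<dots>, \<Psi>\<^sub>N\<close> is the integral against that measure.\<close>

definition quality_index ::
    "nat \<Rightarrow> ((nat \<Rightarrow> 'u) \<Rightarrow> real) \<Rightarrow> ((nat \<Rightarrow> 'u) \<Rightarrow> real) \<Rightarrow> (nat \<Rightarrow> 'u measure) \<Rightarrow> real" where
  "quality_index N A B \<Psi> = (\<integral>u. A u \<partial>PiM {1..N} \<Psi>) / (\<integral>u. B u \<partial>PiM {1..N} \<Psi>)"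

definition admissible ::
    "nat \<Rightarrow> (nat \<Rightarrow> 'u measure) \<Rightarrow> (nat \<Rightarrow> nat \<Rightarrow> real \<Rightarrow> 'u \<Rightarrow> real)
       \<Rightarrow> ((nat \<Rightarrow> 'u) \<Rightarrow> real) \<Rightarrow> ((nat \<Rightarrow> 'u) \<Rightarrow> real) \<Rightarrow> (nat \<Rightarrow> 'u measure set) \<Rightarrow> bool" where
  "admissible N S Q A B G \<longleftrightarrow>
     (\<forall>i\<in>{1..N}. \<forall>\<mu>\<in>G i. prob_space \<mu> \<and> sets \<mu> = sets (S i)) \<and>
     (\<forall>\<Psi>\<in>strategies N G. integrable (PiM {1..N} \<Psi>) A \<and> integrable (PiM {1..N} \<Psi>) B) \<and>
     (\<forall>\<Psi>\<in>strategies N G. (\<integral>u. B u \<partial>PiM {1..N} \<Psi>) \<noteq> 0) \<and>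
     (\<forall>i\<in>{1..N}. degenerate_measures (S i) \<subseteq> G i) \<and>
     (\<forall>\<Psi>\<in>strategies N G. one_positive_recurrent_class {1..N} (transition_prob Q \<Psi>))"


subsection \<open>Optimality\<close>

definition is_max_of :: "('a \<Rightarrow> real) \<Rightarrow> 'a set \<Rightarrow> real \<Rightarrow> bool" where
  "is_max_of f T m \<longleftrightarrow> m \<in> f ` T \<and> (\<forall>x\<in>T. f x \<le> m)"

definition is_min_of :: "('a \<Rightarrow> real) \<Rightarrow> 'a set \<Rightarrow> real \<Rightarrow> bool" where
  "is_min_of f T m \<longleftrightarrow> m \<in> f ` T \<and> (\<forall>x\<in>T. m \<le> f x)"

definition attains_max_at :: "('a \<Rightarrow> real) \<Rightarrow> 'a set \<Rightarrow> 'a \<Rightarrow> bool" where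
  "attains_max_at f T x \<longleftrightarrow> x \<in> T \<and> (\<forall>y\<in>T. f y \<le> f x)"

definition attains_min_at :: "('a \<Rightarrow> real) \<Rightarrow> 'a set \<Rightarrow> 'a \<Rightarrow> bool" where
  "attains_min_at f T x \<longleftrightarrow> x \<in> T \<and> (\<forall>y\<in>T. f x \<le> f y)"

definition eps_optimal_max :: "('a \<Rightarrow> real) \<Rightarrow> 'a set \<Rightarrow> real \<Rightarrow> 'a \<Rightarrow> bool" where
  "eps_optimal_max f T e x \<longleftrightarrow> x \<in> T \<and> bdd_above (f ` T) \<and> f x > Sup (f ` T) - e"

definition eps_optimal_min :: "('a \<Rightarrow> real) \<Rightarrow> 'a set \<Rightarrow> real \<Rightarrow> 'a \<Rightarrow> bool" where
  "eps_optimal_min f T e x \<longleftrightarrow> x \<in> T \<and> bdd_below (f ` T) \<and> f x < Inf (f ` T) + e"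

end

theory Submission
  imports Defs
begin

text \<open>
  If \<open>C = A / B \<le> c\<close> on \<open>U\<close> and \<open>B > 0\<close>, then \<open>A \<le> c * B\<close>; integrating against the product measure
  of a strategy and dividing by the positive integral of \<open>B\<close> gives \<open>I(\<Psi>) \<le> c\<close>. The other signs
  follow by negating \<open>A\<close> or \<open>B\<close>. On the other hand the product of the Dirac measures at \<open>u\<^sub>i\<close> is
  the Dirac measure at \<open>u\<close>, so the deterministic strategy at \<open>u\<close> has index \<open>C u\<close>. Hence \<open>I\<close> on the
  deterministic strategies takes exactly the values of \<open>C\<close>, and every bound for \<open>C\<close> on \<open>U\<close> is a
  bound for \<open>I\<close> on all admissible strategies.
\<close>

section \<open>Bounds for ratios of integrals\<close>

text \<open>For negative \<open>B\<close> the inequality is reversed twice, on multiplying pointwise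
  by \<open>B\<close> and on dividing by its integral, so the same \<open>c\<close> survives for
  either sign.\<close>

lemma integral_ratio_le:
  fixes A B :: "'a \<Rightarrow> real"
  assumes A: "integrable P A" and B: "integrable P B" and nz: "(\<integral>x. B x \<partial>P) \<noteq> 0"
    and sign: "(\<forall>x\<in>space P. B x > 0) \<or> (\<forall>x\<in>space P. B x < 0)"
    and le: "\<And>x. x \<in> space P \<Longrightarrow> A x / B x \<le> c"
  shows "(\<integral>x. A x \<partial>P) / (\<integral>x. B x \<partial>P) \<le> c"
  using sign
proof
  assume pos: "\<forall>x\<in>space P. B x > 0"
  have "(\<integral>x. A x \<partial>P) \<le> (\<integral>x. c * B x \<partial>P)"
    using A B pos le by (intro integral_mono) (auto simp: pos_divide_le_eq)
  \<comment> \<open>Integrating the pointwise sign gives only a weak inequality; \<open>nz\<close>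
    makes it strict.\<close>
  moreover have "(\<integral>x. B x \<partial>P) \<ge> 0"
    using pos by (intro Bochner_Integration.integral_nonneg) (auto intro: less_imp_le)
  ultimately show ?thesis
    using nz by (simp add: pos_divide_le_eq)
next
  assume neg: "\<forall>x\<in>space P. B x < 0"
  have "(\<integral>x. c * B x \<partial>P) \<le> (\<integral>x. A x \<partial>P)"
    using A B neg le by (intro integral_mono) (auto simp: neg_divide_le_eq)
  moreover have "(\<integral>x. - B x \<partial>P) \<ge> 0"
    using neg by (intro Bochner_Integration.integral_nonneg) (auto intro: less_imp_le)
  ultimately show ?thesis
    using nz by (simp add: neg_divide_le_eq)
qed

lemma integral_ratio_ge:
  fixes A B :: "'a \<Rightarrow> real"
  assumes "integrable P A" "integrable P B" "(\<integral>x. B x \<partial>P) \<noteq> 0"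
    and "(\<forall>x\<in>space P. B x > 0) \<or> (\<forall>x\<in>space P. B x < 0)"
    and "\<And>x. x \<in> space P \<Longrightarrow> c \<le> A x / B x"
  shows "c \<le> (\<integral>x. A x \<partial>P) / (\<integral>x. B x \<partial>P)"
  using integral_ratio_le[of P "\<lambda>x. - A x" B "- c"] assms by simp

section \<open>Deterministic strategies and product measures\<close>

text \<open>Measurable coordinate singletons make \<open>return (S i) (u i)\<close> degenerate and
  let the product of these measures be identified as a point mass.\<close>

lemma singleton_control:
  assumes "control_spaces N S" "u \<in> space (control_product N S)" "i \<in> {1..N}"
  shows "{u i} \<in> sets (S i)"
proof -
  have "u i \<in> space (S i)"
    using assms(2,3) unfolding control_product_def space_PiM by (rule PiE_mem)
  then show ?thesis
    using assms(1,3) unfolding control_spaces_def by blast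
qed

lemma point_strategy_deterministic:
  assumes "control_spaces N S" "u \<in> space (control_product N S)"
  shows "point_strategy N S u \<in> deterministic_strategies N S"
proof -
  have "return (S i) (u i) \<in> degenerate_measures (S i)" if "i \<in> {1..N}" for i
  proof -
    have "{u i} \<in> sets (S i)"
      using singleton_control[OF assms that] .
    moreover from this have "u i \<in> space (S i)"
      using sets.sets_into_space by blast
    ultimately have "concentrated_at (S i) (u i) (return (S i) (u i))"
      by (simp add: concentrated_at_iff_return)
    then show ?thesis
      unfolding degenerate_measures_def by blast
  qed
  then show ?thesis
    by (auto simp: point_strategy_def deterministic_strategies_def strategies_def)
qed

lemma quality_index_point_strategy:
  assumes spaces: "control_spaces N S"
    and "A \<in> borel_measurable (control_product N S)" "B \<in> borel_measurable (control_product N S)"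
    and u: "u \<in> space (control_product N S)"
  shows "quality_index N A B (point_strategy N S u) = A u / B u"
proof -
  have "PiM {1..N} (point_strategy N S u) = PiM {1..N} (\<lambda>i. return (S i) (u i))"
    by (rule PiM_cong) (auto simp: point_strategy_def)
  \<comment> \<open>\<open>PiM_return\<close> gives the point mass at the restriction of
    \<open>u\<close> to \<open>{1..N}\<close>. Points of the product space are extensional, so this
    restriction is \<open>u\<close> itself.\<close>
  also have "\<dots> = return (control_product N S) u"
    using PiM_return[of "{1..N}" u S] singleton_control[OF spaces u] u
    by (simp add: control_product_def space_PiM PiE_restrict)
  finally show ?thesis
    using assms by (simp add: quality_index_def integral_return)
qed

lemma deterministic_subset_admissible:
  assumes "admissible N S Q A B G"
  shows "deterministic_strategies N S \<subseteq> strategies N G"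
  using assms unfolding deterministic_strategies_def strategies_def admissible_def
  by (intro PiE_mono) auto

text \<open>Allows a pointwise bound on \<open>U\<close> to be integrated against any admissible
  strategy: the carrier of a product is determined by the \<sigma>-algebras of its factors.\<close>

lemma space_strategy:
  assumes "admissible N S Q A B G" "\<Psi> \<in> strategies N G"
  shows "space (PiM {1..N} \<Psi>) = space (control_product N S)"
proof -
  have "sets (\<Psi> i) = sets (S i)" if "i \<in> {1..N}" for i
    using assms that unfolding admissible_def strategies_def by (blast dest: PiE_mem)
  then show ?thesis
    unfolding control_product_def by (intro sets_eq_imp_space_eq sets_PiM_cong) auto
qed

lemma control_product_nonempty:
  assumes "control_spaces N S"
  shows "space (control_product N S) \<noteq> {}"
  using assms by (auto simp: control_spaces_def control_product_def space_PiM PiE_eq_empty_iff)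

section \<open>Order-theoretic reduction to points\<close>

text \<open>Separates the measure theory from the case analysis. \<open>p\<close> sends a point to
  its deterministic strategy, while \<open>le\<close> and \<open>ge\<close> carry an arbitrary bound
  from \<open>C\<close> to \<open>I\<close>. The bound will be an attained extremum or a supremum or
  infimum that need not be attained.\<close>

locale ratio_reduction =
  fixes I :: "'a \<Rightarrow> real" and C :: "'b \<Rightarrow> real" and p :: "'b \<Rightarrow> 'a"
    and U :: "'b set" and \<Gamma> \<Gamma>d :: "'a set"
  assumes p: "\<And>u. u \<in> U \<Longrightarrow> p u \<in> \<Gamma>d" and sub: "\<Gamma>d \<subseteq> \<Gamma>"
    and val: "\<And>u. u \<in> U \<Longrightarrow> I (p u) = C u"
    and ne: "U \<noteq> {}"
    and le: "\<And>c x. (\<And>v. v \<in> U \<Longrightarrow> C v \<le> c) \<Longrightarrow> x \<in> \<Gamma> \<Longrightarrow> I x \<le> c"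
    and ge: "\<And>c x. (\<And>v. v \<in> U \<Longrightarrow> c \<le> C v) \<Longrightarrow> x \<in> \<Gamma> \<Longrightarrow> c \<le> I x"
begin

section \<open>The maximum problem\<close>

text \<open>By \<open>le\<close>, the number \<open>C u\<close> bounds \<open>I\<close> on
  \<open>\<Gamma>\<close>, hence on the subset \<open>\<Gamma>d\<close>; it is attained on both at
  \<open>p u\<close>.\<close>

lemma max_via_points:
  assumes opt: "attains_max_at C U u"
  shows "p u \<in> \<Gamma>d" "attains_max_at I \<Gamma> (p u)" "is_max_of I \<Gamma> (I (p u))"
    "is_max_of I \<Gamma>d (I (p u))" "is_max_of C U (I (p u))" "I (p u) = C u"
proof -
  have u: "u \<in> U" and max: "\<And>v. v \<in> U \<Longrightarrow> C v \<le> C u"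
    using opt by (auto simp: attains_max_at_def)
  have "I x \<le> C u" if "x \<in> \<Gamma>" for x
    using le[OF max that] .
  with u max show "p u \<in> \<Gamma>d" "attains_max_at I \<Gamma> (p u)" "is_max_of I \<Gamma> (I (p u))"
    "is_max_of I \<Gamma>d (I (p u))" "is_max_of C U (I (p u))" "I (p u) = C u"
    using p[OF u] sub val[OF u]
    by (auto simp: attains_max_at_def is_max_of_def intro: rev_image_eqI)
qed

text \<open>The supremum of \<open>I\<close> over \<open>\<Gamma>\<close> is at most that of
  \<open>C\<close> over \<open>U\<close>, so exceeding the latter minus \<epsilon> is
  enough.\<close>

lemma eps_max_via_points:
  assumes bdd: "bdd_above (C ` U)"
    and u: "u \<in> U" and gt: "(SUP v\<in>U. C v) - \<epsilon> < C u"
  shows "eps_optimal_max I \<Gamma> \<epsilon> (p u)"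
proof -
  have pu: "p u \<in> \<Gamma>"
    using p[OF u] sub by auto
  have I_le: "I x \<le> (SUP v\<in>U. C v)" if "x \<in> \<Gamma>" for x
    using le[OF _ that] bdd by (meson cSUP_upper)
  \<comment> \<open>\<open>pu\<close> supplies the nonemptiness required by
    \<open>cSUP_least\<close>.\<close>
  then have "Sup (I ` \<Gamma>) \<le> (SUP v\<in>U. C v)"
    using pu by (intro cSUP_least) auto
  moreover have "bdd_above (I ` \<Gamma>)"
    using I_le by (rule bdd_aboveI2)
  ultimately show ?thesis
    using pu gt val[OF u] by (auto simp: eps_optimal_max_def)
qed

lemma near_sup_point:
  assumes bdd: "bdd_above (C ` U)" and no: "\<not> (\<exists>u. attains_max_at C U u)" and "\<epsilon> > 0"
  shows "\<exists>u\<in>U. (SUP v\<in>U. C v) - \<epsilon> < C u \<and> C u < (SUP v\<in>U. C v)"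
proof -
  have "(SUP v\<in>U. C v) - \<epsilon> < (SUP v\<in>U. C v)"
    using \<open>\<epsilon> > 0\<close> by simp
  then obtain u where u: "u \<in> U" "(SUP v\<in>U. C v) - \<epsilon> < C u"
    using less_cSUP_iff[OF ne bdd] by blast
  \<comment> \<open>Since \<open>u\<close> is not a maximum point, another value of \<open>C\<close>
    exceeds \<open>C u\<close>; this makes the upper inequality strict.\<close>
  obtain v where "v \<in> U" "C u < C v"
    using no u by (force simp: attains_max_at_def)
  then have "C u < (SUP v\<in>U. C v)"
    using less_cSUP_iff[OF ne bdd] by blast
  with u show ?thesis by blast
qed

text \<open>Every value of \<open>C\<close> is a value of \<open>I\<close> on
  \<open>\<Gamma>\<close>, so the index of an optimal strategy would be an upper bound for
  \<open>C\<close>.\<close>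

lemma unbounded_above_via_points:
  assumes unb: "\<not> bdd_above (C ` U)"
  shows "\<not> (\<exists>x. attains_max_at I \<Gamma> x)"
    and "\<exists>u. (\<forall>n. u n \<in> U \<and> p (u n) \<in> \<Gamma>d \<and> I (p (u n)) = C (u n)) \<and>
           filterlim (\<lambda>n. I (p (u n))) at_top sequentially"
proof -
  show "\<not> (\<exists>x. attains_max_at I \<Gamma> x)"
  proof
    assume "\<exists>x. attains_max_at I \<Gamma> x"
    then obtain x where "\<And>y. y \<in> \<Gamma> \<Longrightarrow> I y \<le> I x"
      by (auto simp: attains_max_at_def)
    then have "C v \<le> I x" if "v \<in> U" for v
      using p[OF that] sub val[OF that] by (metis subsetD)
    then have "bdd_above (C ` U)"
      by (rule bdd_aboveI2)
    with unb show False ..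
  qed
  \<comment> \<open>Otherwise \<open>real n\<close> would be an upper bound for \<open>C\<close>.
    Choosing one such point for each \<open>n\<close> yields a sequence dominating
    \<open>real n\<close>.\<close>
  have "\<exists>u\<in>U. real n \<le> C u" for n
    using unb by (metis bdd_aboveI2 linear)
  then obtain u where u: "\<And>n. u n \<in> U" "\<And>n. real n \<le> C (u n)"
    by metis
  moreover have "filterlim (\<lambda>n. I (p (u n))) at_top sequentially"
    using u by (intro filterlim_at_top_mono[OF filterlim_real_sequentially]) (simp add: val)
  ultimately show "\<exists>u. (\<forall>n. u n \<in> U \<and> p (u n) \<in> \<Gamma>d \<and> I (p (u n)) = C (u n)) \<and>
           filterlim (\<lambda>n. I (p (u n))) at_top sequentially"
    using p val by blast
qed

section \<open>The minimum problem, by the mirrored arguments with \<open>ge\<close>\<close>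

lemma min_via_points:
  assumes opt: "attains_min_at C U u"
  shows "p u \<in> \<Gamma>d" "attains_min_at I \<Gamma> (p u)" "is_min_of I \<Gamma> (I (p u))"
    "is_min_of I \<Gamma>d (I (p u))" "is_min_of C U (I (p u))" "I (p u) = C u"
proof -
  have u: "u \<in> U" and min: "\<And>v. v \<in> U \<Longrightarrow> C u \<le> C v"
    using opt by (auto simp: attains_min_at_def)
  have "C u \<le> I x" if "x \<in> \<Gamma>" for x
    using ge[OF min that] .
  with u min show "p u \<in> \<Gamma>d" "attains_min_at I \<Gamma> (p u)" "is_min_of I \<Gamma> (I (p u))"
    "is_min_of I \<Gamma>d (I (p u))" "is_min_of C U (I (p u))" "I (p u) = C u"
    using p[OF u] sub val[OF u]
    by (auto simp: attains_min_at_def is_min_of_def intro: rev_image_eqI)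
qed

lemma eps_min_via_points:
  assumes bdd: "bdd_below (C ` U)"
    and u: "u \<in> U" and lt: "C u < (INF v\<in>U. C v) + \<epsilon>"
  shows "eps_optimal_min I \<Gamma> \<epsilon> (p u)"
proof -
  have pu: "p u \<in> \<Gamma>"
    using p[OF u] sub by auto
  have I_ge: "(INF v\<in>U. C v) \<le> I x" if "x \<in> \<Gamma>" for x
    using ge[OF _ that] bdd by (meson cINF_lower)
  then have "(INF v\<in>U. C v) \<le> Inf (I ` \<Gamma>)"
    using pu by (intro cINF_greatest) auto
  moreover have "bdd_below (I ` \<Gamma>)"
    using I_ge by (rule bdd_belowI2)
  ultimately show ?thesis
    using pu lt val[OF u] by (auto simp: eps_optimal_min_def)
qed

lemma near_inf_point:
  assumes bdd: "bdd_below (C ` U)" and no: "\<not> (\<exists>u. attains_min_at C U u)" and "\<epsilon> > 0"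
  shows "\<exists>u\<in>U. (INF v\<in>U. C v) < C u \<and> C u < (INF v\<in>U. C v) + \<epsilon>"
proof -
  have "(INF v\<in>U. C v) < (INF v\<in>U. C v) + \<epsilon>"
    using \<open>\<epsilon> > 0\<close> by simp
  then obtain u where u: "u \<in> U" "C u < (INF v\<in>U. C v) + \<epsilon>"
    using cINF_less_iff[OF ne bdd] by blast
  obtain v where "v \<in> U" "C v < C u"
    using no u by (force simp: attains_min_at_def)
  then have "(INF v\<in>U. C v) < C u"
    using cINF_less_iff[OF ne bdd] by blast
  with u show ?thesis by blast
qed

lemma unbounded_below_via_points:
  assumes unb: "\<not> bdd_below (C ` U)"
  shows "\<not> (\<exists>x. attains_min_at I \<Gamma> x)"
    and "\<exists>u. (\<forall>n. u n \<in> U \<and> p (u n) \<in> \<Gamma>d \<and> I (p (u n)) = C (u n)) \<and>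
           filterlim (\<lambda>n. I (p (u n))) at_bot sequentially"
proof -
  show "\<not> (\<exists>x. attains_min_at I \<Gamma> x)"
  proof
    assume "\<exists>x. attains_min_at I \<Gamma> x"
    then obtain x where "\<And>y. y \<in> \<Gamma> \<Longrightarrow> I x \<le> I y"
      by (auto simp: attains_min_at_def)
    then have "I x \<le> C v" if "v \<in> U" for v
      using p[OF that] sub val[OF that] by (metis subsetD)
    then have "bdd_below (C ` U)"
      by (rule bdd_belowI2)
    with unb show False ..
  qed
  have "\<exists>u\<in>U. C u \<le> - real n" for n
    using unb by (metis bdd_belowI2 linear)
  then obtain u where u: "\<And>n. u n \<in> U" "\<And>n. C (u n) \<le> - real n"
    by metis
  \<comment> \<open>Negation turns the bound by \<open>- real n\<close> into a comparison from below
    with \<open>real n\<close>, and divergence to \<open>at_top\<close> is then turned back.\<close>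
  moreover have "filterlim (\<lambda>n. - I (p (u n))) at_top sequentially"
    using u by (intro filterlim_at_top_mono[OF filterlim_real_sequentially])
      (simp add: val le_minus_iff)
  then have "filterlim (\<lambda>n. I (p (u n))) at_bot sequentially"
    by (simp add: filterlim_uminus_at_bot)
  ultimately show "\<exists>u. (\<forall>n. u n \<in> U \<and> p (u n) \<in> \<Gamma>d \<and> I (p (u n)) = C (u n)) \<and>
           filterlim (\<lambda>n. I (p (u n))) at_bot sequentially"
    using p val by blast
qed

end

theorem theorem3:
  fixes N :: nat
    and S :: "nat \<Rightarrow> 'u measure"
    and Q :: "nat \<Rightarrow> nat \<Rightarrow> real \<Rightarrow> 'u \<Rightarrow> real"
    and G :: "nat \<Rightarrow> 'u measure set"
    and M :: "(nat \<Rightarrow> 'u measure) \<Rightarrow> 'w measure"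
    and \<tau> :: "(nat \<Rightarrow> 'u measure) \<Rightarrow> nat \<Rightarrow> 'w \<Rightarrow> real"
    and \<xi> :: "(nat \<Rightarrow> 'u measure) \<Rightarrow> real \<Rightarrow> 'w \<Rightarrow> nat"
    and \<upsilon> :: "(nat \<Rightarrow> 'u measure) \<Rightarrow> nat \<Rightarrow> 'w \<Rightarrow> 'u"
    and A B C :: "(nat \<Rightarrow> 'u) \<Rightarrow> real"
    and U :: "(nat \<Rightarrow> 'u) set"
    and \<Gamma> \<Gamma>d :: "(nat \<Rightarrow> 'u measure) set"
    and I :: "(nat \<Rightarrow> 'u measure) \<Rightarrow> real"
  assumes N: "N \<ge> 1"
    and spaces: "control_spaces N S"
    and Q: "semi_markov_functions N S Q"
    and U_def: "U = space (control_product N S)"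
    and \<Gamma>_def: "\<Gamma> = strategies N G"
    and \<Gamma>d_def: "\<Gamma>d = deterministic_strategies N S"
    and I_def: "I = quality_index N A B"
    and C_def: "C = (\<lambda>u. A u / B u)"
    and process: "\<And>\<Psi>. \<Psi> \<in> \<Gamma> \<Longrightarrow>
          controlled_semi_markov_process N S Q \<Psi> (M \<Psi>) (\<tau> \<Psi>) (\<xi> \<Psi>) (\<upsilon> \<Psi>)"
    and A: "A \<in> borel_measurable (control_product N S)"
    and B: "B \<in> borel_measurable (control_product N S)"
    and adm: "admissible N S Q A B G"
    and sign: "(\<forall>u\<in>U. B u > 0) \<or> (\<forall>u\<in>U. B u < 0)"
  shows
    "(\<forall>u. bdd_above (C ` U) \<and> attains_max_at C U u \<longrightarrow>
       point_strategy N S u \<in> \<Gamma>d \<and>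
       attains_max_at I \<Gamma> (point_strategy N S u) \<and>
       is_max_of I \<Gamma> (I (point_strategy N S u)) \<and>
       is_max_of I \<Gamma>d (I (point_strategy N S u)) \<and>
       is_max_of (\<lambda>v. A v / B v) U (I (point_strategy N S u)) \<and>
       I (point_strategy N S u) = A u / B u) \<and>
     (\<forall>u. bdd_below (C ` U) \<and> attains_min_at C U u \<longrightarrow>
       point_strategy N S u \<in> \<Gamma>d \<and>
       attains_min_at I \<Gamma> (point_strategy N S u) \<and>
       is_min_of I \<Gamma> (I (point_strategy N S u)) \<and>
       is_min_of I \<Gamma>d (I (point_strategy N S u)) \<and>
       is_min_of (\<lambda>v. A v / B v) U (I (point_strategy N S u)) \<and>
       I (point_strategy N S u) = A u / B u) \<and>
     (bdd_above (C ` U) \<and> \<not> (\<exists>u. attains_max_at C U u) \<longrightarrow>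
       (\<forall>\<epsilon>>0.
          (\<exists>u\<in>U. (SUP v\<in>U. A v / B v) - \<epsilon> < A u / B u \<and> A u / B u < (SUP v\<in>U. A v / B v)) \<and>
          (\<forall>u\<in>U. (SUP v\<in>U. A v / B v) - \<epsilon> < A u / B u \<and> A u / B u < (SUP v\<in>U. A v / B v) \<longrightarrow>
             point_strategy N S u \<in> \<Gamma>d \<and> eps_optimal_max I \<Gamma> \<epsilon> (point_strategy N S u)))) \<and>
     (bdd_below (C ` U) \<and> \<not> (\<exists>u. attains_min_at C U u) \<longrightarrow>
       (\<forall>\<epsilon>>0.
          (\<exists>u\<in>U. (INF v\<in>U. A v / B v) < A u / B u \<and> A u / B u < (INF v\<in>U. A v / B v) + \<epsilon>) \<and>
          (\<forall>u\<in>U. (INF v\<in>U. A v / B v) < A u / B u \<and> A u / B u < (INF v\<in>U. A v / B v) + \<epsilon> \<longrightarrow>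
             point_strategy N S u \<in> \<Gamma>d \<and> eps_optimal_min I \<Gamma> \<epsilon> (point_strategy N S u)))) \<and>
     (\<not> bdd_above (C ` U) \<longrightarrow>
       \<not> (\<exists>\<Psi>. attains_max_at I \<Gamma> \<Psi>) \<and>
       (\<exists>u :: nat \<Rightarrow> nat \<Rightarrow> 'u.
          (\<forall>n. u n \<in> U \<and> point_strategy N S (u n) \<in> \<Gamma>d \<and>
               I (point_strategy N S (u n)) = A (u n) / B (u n)) \<and>
          filterlim (\<lambda>n. I (point_strategy N S (u n))) at_top sequentially)) \<and>
     (\<not> bdd_below (C ` U) \<longrightarrow>
       \<not> (\<exists>\<Psi>. attains_min_at I \<Gamma> \<Psi>) \<and>
       (\<exists>u :: nat \<Rightarrow> nat \<Rightarrow> 'u.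
          (\<forall>n. u n \<in> U \<and> point_strategy N S (u n) \<in> \<Gamma>d \<and>
               I (point_strategy N S (u n)) = A (u n) / B (u n)) \<and>
          filterlim (\<lambda>n. I (point_strategy N S (u n))) at_bot sequentially))"
proof -
  interpret ratio_reduction I C "point_strategy N S" U \<Gamma> \<Gamma>d
  proof
    show "U \<noteq> {}"
      using control_product_nonempty[OF spaces] by (simp add: U_def)
    show "\<Gamma>d \<subseteq> \<Gamma>"
      using deterministic_subset_admissible[OF adm] by (simp add: \<Gamma>_def \<Gamma>d_def)
    show "point_strategy N S u \<in> \<Gamma>d" if "u \<in> U" for u
      using point_strategy_deterministic[OF spaces] that by (simp add: U_def \<Gamma>d_def)
    show "I (point_strategy N S u) = C u" if "u \<in> U" for u
      using quality_index_point_strategy[OF spaces A B] that by (simp add: U_def I_def C_def)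
    \<comment> \<open>\<open>space_strategy\<close> identifies the domain of integration with
      \<open>U\<close>, where the bound and the sign condition hold; \<open>adm\<close> supplies
      integrability and the nonzero denominator.\<close>
    show "I \<Psi> \<le> c" if "\<And>v. v \<in> U \<Longrightarrow> C v \<le> c" "\<Psi> \<in> \<Gamma>" for c \<Psi>
      using that sign adm space_strategy[OF adm, of \<Psi>]
      unfolding I_def quality_index_def
      by (intro integral_ratio_le) (auto simp: U_def \<Gamma>_def C_def admissible_def)
    show "c \<le> I \<Psi>" if "\<And>v. v \<in> U \<Longrightarrow> c \<le> C v" "\<Psi> \<in> \<Gamma>" for c \<Psi>
      using that sign adm space_strategy[OF adm, of \<Psi>]
      unfolding I_def quality_index_def
      by (intro integral_ratio_ge) (auto simp: U_def \<Gamma>_def C_def admissible_def)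
  qed
  have C_eq: "A u / B u = C u" for u
    by (simp add: C_def)
  show ?thesis
    \<comment> \<open>With the quotients folded into \<open>C\<close>, splitting the conjunctions
      and premises leaves goals that match conclusions of the locale; \<open>p\<close> gives
      membership in \<open>\<Gamma>d\<close> in the \<epsilon>-optimal cases.\<close>
    unfolding C_eq
    by (intro conjI impI allI ballI; (elim conjE)?;
        intro max_via_points min_via_points near_sup_point near_inf_point p
          eps_max_via_points eps_min_via_points
          unbounded_above_via_points unbounded_below_via_points; assumption)
qed

end
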